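(* Let $\lambda=(\lambda_n)_{n\in\mathbb N}$ be a frequency and $k\ge0$. Suppose that at least one of the following two conditions holds: (i) $k\le1$; (ii) there are $c_1,c_2>0$ such that, for all $n\ge2$, $$c_1\le\frac{\lambda_{n+1}-\lambda_n}{\lambda_n-\lambda_{n-1}}\le c_2.$$ Let $(\rho_n)_{n\in\mathbb N}$ be a sequence of positive numbers such that, for every $D\in\mathcal D^{\mathrm{ext}}_{\infty,k}(\lambda)$, $a_n(D)=O(\rho_n)$ as $n\to\infty$ (the implied constant may depend on $D$). Then $$\left(\frac1{\varepsilon_n}\right)^k=O(\rho_n).$$
   Context: $\mathbb N=\{1,2,\dots\}$ and $\mathbb C_\theta=\{s\in\mathbb C:\operatorname{Re}s>\theta\}$. A frequency is a strictly increasing sequence $\lambda=(\lambda_n)_{n\in\mathbb N}$ of non-negative reals tending to infinity. Put $\varepsilon_1=\min\{1,\lambda_2-\lambda_1\}$ and $\varepsilon_n=\min\{1,\lambda_n-\lambda_{n-1},\lambda_{n+1}-\lambda_n\}$ for $n\ge2$. $\mathcal D(\lambda)$ is the space of all formal $\lambda$-Dirichlet series $D=\sum_{n=1}^\infty a_n(D)e^{-\lambda_n s}$ with $a_n(D)\in\mathbb C$. For real $l\ge0$, $x>0$ and $s\in\mathbb C$ let $$R^{\lambda,l}_x(D)(s)=\sum_{\lambda_n\le x}a_n(D)\left(1-\frac{\lambda_n}{x}\right)^l e^{-\lambda_n s}$$ (with $0^0=1$). $D$ is $(\lambda,l)$-summable at $s$ if $\lim_{x\to\infty}R^{\lambda,l}_x(D)(s)$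 exists. Put $\sigma^{\lambda,l}(D)=\inf\{\sigma\in\mathbb R: D\text{ is }(\lambda,l)\text{-summable at }\sigma\}$ (infimum in $[-\infty,\infty]$). It is known that $(\lambda,l)$-summability at $s_0$ implies $(\lambda,l)$-summability on $\mathbb C_{\operatorname{Re}s_0}$ with holomorphic limit function, and that $(\lambda,l)$-summability implies $(\lambda,l')$-summability to the same limit for $l'\ge l$. For $k\ge0$, $\mathcal D^{\mathrm{ext}}_{\infty,k}(\lambda)$ is the space of all $D\in\mathcal D(\lambda)$ for which there is $l\ge0$ with $\sigma^{\lambda,l}(D)<\infty$ such that the limit function $f(s)=\lim_{x\to\infty}R^{\lambda,l}_x(D)(s)$, $s\in\mathbb C_{\sigma^{\lambda,l}(D)}$, has a holomorphic extension to $\mathbb C_0$, again denoted $f=f_D$ (it does not depend on $l$), satisfying $\sup_{s\in\mathbb C_0}|f_D(s)|/(1+|s|)^k<\infty$. *)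

theory Defs
  imports
    "HOL-Complex_Analysis.Complex_Analysis"
    "HOL-Library.Landau_Symbols"
    "HOL-Library.Extended_Real"
begin

text \<open>
  Sequences are indexed by the positive integers: a sequence is a function on \<^typ>\<open>nat\<close> whose
  value at 0 is never used.
\<close>

definition frequency :: "(nat \<Rightarrow> real) \<Rightarrow> bool" where
  "frequency lam \<longleftrightarrow>
     strict_mono_on {1..} lam \<and> (\<forall>n\<ge>1. 0 \<le> lam n) \<and> filterlim lam at_top sequentially"

definition freq_gap :: "(nat \<Rightarrow> real) \<Rightarrow> nat \<Rightarrow> real" where
  "freq_gap lam n =
     (if n = 1 then min 1 (lam 2 - lam 1)
      else Min {1, lam n - lam (n - 1), lam (n + 1) - lam n})"

text \<open>
  A formal Dirichlet series with frequency \<open>lam\<close> is represented by its coefficient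
  sequence \<open>a\<close>.  The exponent \<open>l = 0\<close> is separated in the Riesz weight because the mathematical
  convention is \<open>0 ^ 0 = 1\<close>, whereas \<open>0 powr 0 = 0\<close>.
\<close>

definition riesz_mean ::
  "(nat \<Rightarrow> real) \<Rightarrow> real \<Rightarrow> real \<Rightarrow> (nat \<Rightarrow> complex) \<Rightarrow> complex \<Rightarrow> complex" where
  "riesz_mean lam l x a s =
     (\<Sum>n | 1 \<le> n \<and> lam n \<le> x.
        a n * complex_of_real (if l = 0 then 1 else (1 - lam n / x) powr l)
            * exp (- complex_of_real (lam n) * s))"

definition riesz_summable ::
  "(nat \<Rightarrow> real) \<Rightarrow> real \<Rightarrow> (nat \<Rightarrow> complex) \<Rightarrow> complex \<Rightarrow> bool" where
  "riesz_summable lam l a s \<longleftrightarrow> (\<exists>L. ((\<lambda>x. riesz_mean lam l x a s) \<longlongrightarrow> L) at_top)"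

definition riesz_abscissa :: "(nat \<Rightarrow> real) \<Rightarrow> real \<Rightarrow> (nat \<Rightarrow> complex) \<Rightarrow> ereal" where
  "riesz_abscissa lam l a =
     Inf (ereal ` {\<sigma>::real. riesz_summable lam l a (complex_of_real \<sigma>)})"

text \<open>
  If the abscissa is negative, the limit function is already defined on the right half-plane;
  then \<open>f\<close> is its restriction, which is why agreement is only required where \<open>Re s > 0\<close>.
\<close>

definition dirichlet_ext :: "(nat \<Rightarrow> real) \<Rightarrow> real \<Rightarrow> (nat \<Rightarrow> complex) set" where
  "dirichlet_ext lam k =
     {a. \<exists>l\<ge>0. riesz_abscissa lam l a < \<infinity> \<and>
        (\<exists>f. f holomorphic_on {s. 0 < Re s} \<and>
             (\<forall>s. 0 < Re s \<and> riesz_abscissa lam l a < ereal (Re s) \<longrightarrow>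
                 ((\<lambda>x. riesz_mean lam l x a s) \<longlongrightarrow> f s) at_top) \<and>
             bdd_above ((\<lambda>s. norm (f s) / (1 + norm s) powr k) ` {s. 0 < Re s}))}"

end

theory Submission
  imports Defs
begin

text \<open>
  The proof is a gliding-hump argument.  For every large index \<open>n\<close> one needs a Dirichlet polynomial
  concentrated near \<open>n\<close> whose \<open>n\<close>-th coefficient is \<open>(1 / freq_gap lam n) powr k\<close> and whose size is
  at most a constant, independent of \<open>n\<close>, times \<open>(1 + norm s) powr k\<close>.  If the asserted bound failed,
  such polynomials for a sparse sequence of indices, with weights \<open>2 ^ (- j)\<close>, would add up to a
  series in \<open>dirichlet_ext lam k\<close> whose coefficients are not \<open>O(\<rho>)\<close>.

  The polynomials are interpolation errors.  Let \<open>J\<close> be a set of \<open>m \<ge> k\<close> indices near \<open>n\<close>, all of whose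
  frequencies lie within a multiple of \<open>\<epsilon> = freq_gap lam n\<close> of \<open>lam n\<close>, and map a function \<open>g\<close> to the
  difference between \<open>g (lam n)\<close> and the value there of the Lagrange interpolant of \<open>g\<close> at the nodes
  \<open>lam i\<close>, \<open>i \<in> J\<close>.  This functional kills polynomials of degree less than \<open>m\<close>, so by
  Taylor's formula it is at most a constant times \<open>\<epsilon> ^ m\<close> times a bound for the \<open>m\<close>-th derivative
  (\<open>interpolation_error_bound\<close>), provided that the Lagrange coefficients are bounded.  It is also at
  most a constant times a bound for \<open>g\<close> itself.  For \<open>g t = exp (- t * s)\<close> the two bounds
  interpolate to a constant times \<open>(\<epsilon> * (1 + norm s)) powr k\<close>, and the coefficient of
  \<open>exp (- lam n * s)\<close> is \<open>1\<close>; division by \<open>\<epsilon> powr k\<close> gives the required polynomial.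

  The coefficients so obtained may be enormous compared with \<open>exp (lam n * \<sigma>)\<close> for every \<open>\<sigma>\<close>, so
  the partial sums of the final series need not converge anywhere.  Its Riesz means do: the mean of
  order \<open>m + 1\<close> of a polynomial is the same functional applied to
  \<open>(max 0 (1 - t / x)) ^ (m + 1) * exp (- t * s)\<close>, whose \<open>m\<close>-th derivative is bounded uniformly in
  \<open>x \<ge> 1\<close>.  Hence the same estimate holds for all means
  (\<open>norm_riesz_mean_block_le\<close>), dominated convergence yields Riesz summability on the closed right
  half-plane, and the growth bound for the limit comes for free
  (\<open>dominated_series_in_dirichlet_ext\<close>).

  The hypotheses on \<open>k\<close> and \<open>lam\<close> serve only to provide nodes.  For \<open>k \<le> 1\<close> the nearest neighbour of
  \<open>lam n\<close> suffices, with Lagrange coefficient \<open>1\<close>; if consecutive gaps are comparable, the next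
  \<open>m\<close> frequencies do.  If \<open>freq_gap lam n = 1\<close>, the single term \<open>exp (- lam n * s)\<close> is good enough and
  no nodes are used.
\<close>

section \<open>Errors of Lagrange interpolation\<close>

definition lagrange_basis :: "real set \<Rightarrow> real \<Rightarrow> real \<Rightarrow> real" where
  "lagrange_basis T t x = (\<Prod>u\<in>T - {t}. (x - u) / (t - u))"

lemma lagrange_interpolation:
  fixes p :: "real poly"
  assumes "finite T" "degree p < card T"
  shows "(\<Sum>t\<in>T. lagrange_basis T t x * poly p t) = poly p x"
proof -
  define L where "L t = (\<Prod>u\<in>T - {t}. [:- u / (t - u), 1 / (t - u):])" for t
  define q where "q = (\<Sum>t\<in>T. smult (poly p t) (L t))"
  have poly_L: "poly (L t) y = lagrange_basis T t y" for t y
    unfolding L_def lagrange_basis_def poly_prod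
    by (rule prod.cong) (simp_all add: diff_divide_distrib)
  have deg_L: "degree (L t) < card T" if "t \<in> T" for t
  proof -
    have "degree (L t) \<le> (\<Sum>u\<in>T - {t}. degree [:- u / (t - u), 1 / (t - u):])"
      unfolding L_def using degree_prod_sum_le[of "T - {t}" "\<lambda>u. [:- u / (t - u), 1 / (t - u):]"]
        assms(1) by (simp add: o_def)
    also have "\<dots> \<le> (\<Sum>u\<in>T - {t}. 1)"
      by (rule sum_mono) simp
    also have "\<dots> < card T"
      using card_Diff1_less[OF assms(1) that] by simp
    finally show ?thesis .
  qed
  have "degree q < card T"
    unfolding q_def using deg_L assms
    by (intro degree_sum_less) (auto intro: le_less_trans[OF degree_smult_le])
  moreover have "poly q y = poly p y" if "y \<in> T" for y
  proof -
    have "poly (L t) y = (if t = y then 1 else 0)" if "t \<in> T" for t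
    proof (cases "t = y")
      case True
      then show ?thesis
        unfolding poly_L lagrange_basis_def by (auto intro!: prod.neutral)
    next
      case False
      then have "y \<in> T - {t}" using \<open>y \<in> T\<close> by auto
      then show ?thesis
        unfolding poly_L lagrange_basis_def using False assms(1)
        by (auto intro!: prod_zero bexI[of _ y])
    qed
    then have "poly q y = (\<Sum>t\<in>T. if t = y then poly p t else 0)"
      unfolding q_def poly_sum by (intro sum.cong) auto
    then show ?thesis using that assms(1) by simp
  qed
  ultimately have "q = p"
    using assms by (intro poly_eqI_degree[of T]) auto
  then have "poly p x = poly q x" by simp
  also have "\<dots> = (\<Sum>t\<in>T. lagrange_basis T t x * poly p t)"
    unfolding q_def poly_sum by (intro sum.cong) (auto simp: poly_L)
  finally show ?thesis by simp
qed

text \<open>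
  Only the \<open>m\<close>-th derivative is bounded by \<open>B\<close>.  The recursion keeps the derivatives anonymous, so that
  no explicit formula for higher derivatives of the Riesz kernel is needed.
\<close>
primrec deriv_bounded :: "nat \<Rightarrow> real \<Rightarrow> (real \<Rightarrow> complex) \<Rightarrow> bool" where
  "deriv_bounded 0 B g \<longleftrightarrow> (\<forall>t\<ge>0. norm (g t) \<le> B)"
| "deriv_bounded (Suc m) B g \<longleftrightarrow>
     (\<exists>g'. (\<forall>t\<ge>0. (g has_vector_derivative g' t) (at t within {0..})) \<and> deriv_bounded m B g')"

lemma deriv_bounded_mono: "deriv_bounded m A g \<Longrightarrow> A \<le> B \<Longrightarrow> deriv_bounded m B g"
  by (induction m arbitrary: g) (auto intro: order_trans)

lemma deriv_bounded_lincomb: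
  assumes "deriv_bounded m A g" "deriv_bounded m B h"
  shows "deriv_bounded m (norm c * A + norm d * B) (\<lambda>t. c * g t + d * h t)"
  using assms
proof (induction m arbitrary: g h)
  case 0
  show ?case
    unfolding deriv_bounded.simps
  proof (intro allI impI)
    fix t :: real assume "t \<ge> 0"
    have "norm (c * g t + d * h t) \<le> norm c * norm (g t) + norm d * norm (h t)"
      by (metis norm_mult norm_triangle_ineq)
    also have "\<dots> \<le> norm c * A + norm d * B"
      using 0 \<open>t \<ge> 0\<close> by (intro add_mono mult_left_mono) auto
    finally show "norm (c * g t + d * h t) \<le> norm c * A + norm d * B" .
  qed
next
  case (Suc m)
  then obtain g' h' where
    g': "\<And>t. t \<ge> 0 \<Longrightarrow> (g has_vector_derivative g' t) (at t within {0..})" "deriv_bounded m A g'" and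
    h': "\<And>t. t \<ge> 0 \<Longrightarrow> (h has_vector_derivative h' t) (at t within {0..})" "deriv_bounded m B h'"
    by auto
  have "((\<lambda>t. c * g t + d * h t) has_vector_derivative (c * g' t + d * h' t)) (at t within {0..})"
    if "t \<ge> 0" for t
    using g'(1)[OF that] h'(1)[OF that] by (auto intro!: derivative_eq_intros)
  with Suc.IH[OF g'(2) h'(2)] show ?case
    unfolding deriv_bounded.simps by (intro exI[of _ "\<lambda>t. c * g' t + d * h' t"]) auto
qed

text \<open>
  Taylor's formula by induction: integrate the Taylor polynomial of the derivative termwise and
  estimate the remainder by the mean value inequality on the segment from \<open>x\<close> to \<open>t\<close>.
  Only the size of the remainder matters below, so the coefficients stay anonymous.
\<close>
lemma deriv_bounded_taylor:
  assumes "deriv_bounded m B g" "x \<ge> 0"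
  shows "\<exists>c. \<forall>t\<ge>0. norm (g t - (\<Sum>i<m. c i * of_real ((t - x) ^ i))) \<le> B * \<bar>t - x\<bar> ^ m"
  using assms(1)
proof (induction m arbitrary: g)
  case 0
  then show ?case by simp
next
  case (Suc m)
  then obtain g' where
    g': "\<And>t. t \<ge> 0 \<Longrightarrow> (g has_vector_derivative g' t) (at t within {0..})" "deriv_bounded m B g'"
    by auto
  from Suc.IH[OF g'(2)] obtain c where
    c: "\<And>t. t \<ge> 0 \<Longrightarrow> norm (g' t - (\<Sum>i<m. c i * of_real ((t - x) ^ i))) \<le> B * \<bar>t - x\<bar> ^ m"
    by auto
  \<comment> \<open>The Taylor coefficients of \<open>g\<close> at \<open>x\<close>, obtained from those of the derivative by integration.\<close>
  define d where "d i = (case i of 0 \<Rightarrow> g x | Suc j \<Rightarrow> c j / of_nat (Suc j))" for i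
  define G where "G t = g t - (\<Sum>i<Suc m. d i * of_real ((t - x) ^ i))" for t
  have B0: "0 \<le> B"
    using order_trans[OF norm_ge_zero c[of "x + 1"]] \<open>x \<ge> 0\<close> by simp
  have G': "(G has_vector_derivative (g' t - (\<Sum>i<m. c i * of_real ((t - x) ^ i)))) (at t within S)"
    if "t \<ge> 0" "S \<subseteq> {0..}" for t S
  proof -
    have "((\<lambda>t. (t - x) ^ Suc i) has_real_derivative real (Suc i) * (t - x) ^ i) (at t within S)" for i
      by (rule derivative_eq_intros refl)+ simp
    then have "((\<lambda>t. of_real ((t - x) ^ Suc i) :: complex) has_vector_derivative
            of_real (real (Suc i) * (t - x) ^ i)) (at t within S)" for i
      by (rule has_vector_derivative_of_real)
    then have "((\<lambda>t. d (Suc i) * of_real ((t - x) ^ Suc i)) has_vector_derivative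
            d (Suc i) * of_real (real (Suc i) * (t - x) ^ i)) (at t within S)" for i
      by (rule has_vector_derivative_mult_right)
    moreover have "d (Suc i) * of_real (real (Suc i) * (t - x) ^ i) = c i * of_real ((t - x) ^ i)" for i
      by (simp add: d_def field_simps del: of_nat_Suc)
    ultimately have *: "((\<lambda>t. d (Suc i) * of_real ((t - x) ^ Suc i)) has_vector_derivative
            c i * of_real ((t - x) ^ i)) (at t within S)" for i
      by metis
    have "((\<lambda>t. g t - (d 0 + (\<Sum>i<m. d (Suc i) * of_real ((t - x) ^ Suc i)))) has_vector_derivative
            (g' t - (0 + (\<Sum>i<m. c i * of_real ((t - x) ^ i))))) (at t within S)"
      by (intro has_vector_derivative_diff has_vector_derivative_add has_vector_derivative_const
          has_vector_derivative_sum * has_vector_derivative_within_subset[OF g'(1)] that)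
    moreover have "G = (\<lambda>t. g t - (d 0 + (\<Sum>i<m. d (Suc i) * of_real ((t - x) ^ Suc i))))"
      unfolding G_def sum.lessThan_Suc_shift by (simp add: d_def)
    ultimately show ?thesis by simp
  qed
  have "norm (G t) \<le> B * \<bar>t - x\<bar> ^ Suc m" if "t \<ge> 0" for t
  proof -
    let ?S = "closed_segment x t"
    have S: "?S \<subseteq> {0..}"
      using that \<open>x \<ge> 0\<close> by (auto simp: closed_segment_eq_real_ivl split: if_splits)
    have "norm (G t - G x) \<le> (B * \<bar>t - x\<bar> ^ m) * norm (t - x)"
    proof (rule differentiable_bound[where S = ?S])
      fix u assume u: "u \<in> ?S"
      then have "u \<ge> 0" using S by auto
      show "(G has_derivative (\<lambda>h. h *\<^sub>R (g' u - (\<Sum>i<m. c i * of_real ((u - x) ^ i))))) (at u within ?S)"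
        using G'[OF \<open>u \<ge> 0\<close> S] by (simp add: has_vector_derivative_def)
      have "\<bar>u - x\<bar> \<le> \<bar>t - x\<bar>"
        using u by (auto simp: closed_segment_eq_real_ivl split: if_splits)
      then have "B * \<bar>u - x\<bar> ^ m \<le> B * \<bar>t - x\<bar> ^ m"
        using B0 by (intro mult_left_mono power_mono) auto
      then have le: "norm (g' u - (\<Sum>i<m. c i * of_real ((u - x) ^ i))) \<le> B * \<bar>t - x\<bar> ^ m"
        using c[OF \<open>u \<ge> 0\<close>] by linarith
      show "onorm (\<lambda>h. h *\<^sub>R (g' u - (\<Sum>i<m. c i * of_real ((u - x) ^ i)))) \<le> B * \<bar>t - x\<bar> ^ m"
      proof (rule onorm_le)
        fix h :: real
        show "norm (h *\<^sub>R (g' u - (\<Sum>i<m. c i * of_real ((u - x) ^ i)))) \<le> B * \<bar>t - x\<bar> ^ m * norm h"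
          unfolding norm_scaleR using mult_left_mono[OF le, of "\<bar>h\<bar>"] by (simp add: mult.commute)
      qed
    qed auto
    moreover have "G x = 0"
      unfolding G_def sum.lessThan_Suc_shift by (simp add: d_def)
    ultimately show ?thesis by (simp add: mult_ac)
  qed
  then show ?case unfolding G_def by blast
qed

text \<open>
  Interpolation at \<open>card T\<close> nodes reproduces the Taylor polynomial of \<open>g\<close> of degree less than
  \<open>card T\<close> at \<open>x\<close>, so only the Taylor remainders at the nodes contribute to the error.
\<close>
lemma interpolation_error_bound:
  fixes x r K B :: real
  assumes T: "finite T" "T \<noteq> {}" "T \<subseteq> {0..}" and x: "x \<ge> 0"
    and g: "deriv_bounded (card T) B g"
    and r: "\<And>t. t \<in> T \<Longrightarrow> \<bar>t - x\<bar> \<le> r"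
    and K: "\<And>t. t \<in> T \<Longrightarrow> \<bar>lagrange_basis T t x\<bar> \<le> K"
  shows "norm (g x - (\<Sum>t\<in>T. of_real (lagrange_basis T t x) * g t)) \<le> card T * K * r ^ card T * B"
proof -
  let ?m = "card T"
  have m0: "?m > 0" using T by (simp add: card_gt_0_iff)
  obtain c where
    c: "\<And>t. t \<ge> 0 \<Longrightarrow> norm (g t - (\<Sum>i<?m. c i * of_real ((t - x) ^ i))) \<le> B * \<bar>t - x\<bar> ^ ?m"
    using deriv_bounded_taylor[OF g x] by blast
  define Q where "Q t = (\<Sum>i<?m. c i * of_real ((t - x) ^ i))" for t
  have B0: "0 \<le> B"
    using order_trans[OF norm_ge_zero c[of "x + 1"]] \<open>x \<ge> 0\<close> by simp
  obtain t0 where "t0 \<in> T" using T by auto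
  then have K0: "0 \<le> K" and r0: "0 \<le> r" using K[of t0] r[of t0] by linarith+
  \<comment> \<open>Interpolating the powers of \<open>t - x\<close> and evaluating at \<open>x\<close> itself leaves only the power \<open>0\<close>.\<close>
  have moments: "(\<Sum>t\<in>T. lagrange_basis T t x * (t - x) ^ i) = 0 ^ i" if "i < ?m" for i
  proof -
    have "degree ([:- x, 1:] ^ i) < ?m" using that by (simp add: degree_linear_power)
    from lagrange_interpolation[OF T(1) this, of x] show ?thesis by simp
  qed
  have "(\<Sum>t\<in>T. of_real (lagrange_basis T t x) * Q t) =
        (\<Sum>t\<in>T. \<Sum>i<?m. c i * of_real (lagrange_basis T t x * (t - x) ^ i))"
    unfolding Q_def by (simp add: sum_distrib_left mult_ac)
  also have "\<dots> = (\<Sum>i<?m. c i * of_real (\<Sum>t\<in>T. lagrange_basis T t x * (t - x) ^ i))"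
    by (subst sum.swap) (simp add: sum_distrib_left)
  also have "\<dots> = Q x"
    unfolding Q_def by (intro sum.cong) (simp_all add: moments)
  also have "Q x = g x"
  proof -
    have "norm (g x - Q x) \<le> 0" using c[OF x] m0 by (simp add: Q_def zero_power)
    then show ?thesis by simp
  qed
  finally have "g x - (\<Sum>t\<in>T. of_real (lagrange_basis T t x) * g t) =
      (\<Sum>t\<in>T. of_real (lagrange_basis T t x) * (Q t - g t))"
    by (simp add: sum_subtractf ring_distribs)
  also have "norm \<dots> \<le> (\<Sum>t\<in>T. K * (B * r ^ ?m))"
  proof (rule sum_norm_le)
    fix t assume t: "t \<in> T"
    have "norm (Q t - g t) \<le> B * \<bar>t - x\<bar> ^ ?m"
      unfolding Q_def norm_minus_commute[of _ "g t"] using c t T by auto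
    also have "\<dots> \<le> B * r ^ ?m"
      using B0 r[OF t] by (intro mult_left_mono power_mono) auto
    finally show "norm (of_real (lagrange_basis T t x) * (Q t - g t)) \<le> K * (B * r ^ ?m)"
      unfolding norm_mult using K[OF t] K0 by (intro mult_mono) auto
  qed
  finally show ?thesis by (simp add: mult_ac)
qed

section \<open>The kernel of the Riesz means\<close>

text \<open>
  The truncation \<open>lam n \<le> x\<close> in a Riesz mean is absorbed into the positive part, which turns the mean
  into a fixed linear functional applied to a function that is smooth enough across \<open>t = x\<close>.
\<close>
definition riesz_kernel :: "nat \<Rightarrow> real \<Rightarrow> complex \<Rightarrow> real \<Rightarrow> complex" where
  "riesz_kernel p x s t = of_real (max 0 (1 - t / x) ^ p) * exp (- of_real t * s)"

lemma norm_riesz_kernel_le: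
  assumes "0 \<le> t" "0 < x" "0 \<le> Re s"
  shows "norm (riesz_kernel p x s t) \<le> 1"
proof -
  have "max 0 (1 - t / x) ^ p \<le> 1"
    using assms by (intro power_le_one) auto
  moreover have "norm (exp (- of_real t * s)) \<le> 1"
    using assms by simp
  ultimately show ?thesis
    unfolding riesz_kernel_def norm_mult norm_of_real by (intro mult_le_one) auto
qed

text \<open>
  At \<open>u = 0\<close> the function is differentiable because it is dominated by \<open>u ^ 2\<close> nearby; hence \<open>p \<ge> 2\<close>.
\<close>
lemma DERIV_max_0_power:
  assumes "p \<ge> 2"
  shows "((\<lambda>u::real. max 0 u ^ p) has_real_derivative real p * max 0 u ^ (p - 1)) (at u)"
proof -
  consider "u < 0" | "u > 0" | "u = 0" by linarith
  then show ?thesis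
  proof cases
    case 1
    have "((\<lambda>u::real. 0) has_real_derivative 0) (at u)" by simp
    then have "((\<lambda>u. max 0 u ^ p) has_real_derivative 0) (at u)"
      by (rule has_field_derivative_transform_within_open[where S = "{..<0}"])
         (use 1 assms in \<open>auto simp: max_def\<close>)
    moreover have "max 0 u ^ (p - 1) = 0" using 1 assms by (simp add: max_def power_0_left)
    ultimately show ?thesis by (simp only: mult_zero_right)
  next
    case 2
    have "((\<lambda>u::real. u ^ p) has_real_derivative real p * u ^ (p - 1)) (at u)"
      by (auto intro!: derivative_eq_intros)
    then have "((\<lambda>u. max 0 u ^ p) has_real_derivative real p * u ^ (p - 1)) (at u)"
      by (rule has_field_derivative_transform_within_open[where S = "{0<..}"])
         (use 2 in \<open>auto simp: max_def\<close>)
    then show ?thesis using 2 by (simp add: max_def)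
  next
    case 3
    obtain q where q: "p = Suc (Suc q)" using assms by (metis add_2_eq_Suc le_Suc_ex)
    have "((\<lambda>h. (max 0 (0 + h) ^ p - max 0 0 ^ p) / h) \<longlongrightarrow> (0::real)) (at 0)"
    proof (rule Lim_null_comparison)
      have "norm ((max 0 (0 + h) ^ p - max 0 0 ^ p) / h) \<le> \<bar>h\<bar> ^ Suc q" for h :: real
      proof (cases "h \<le> 0")
        case True
        have "0 \<le> \<bar>h\<bar> ^ Suc q" by (intro zero_le_power) simp
        with True show ?thesis by (simp add: q)
      next
        case False
        then show ?thesis by (simp add: q)
      qed
      then show "\<forall>\<^sub>F h in at 0. norm ((max 0 (0 + h) ^ p - max 0 0 ^ p) / h) \<le> \<bar>h\<bar> ^ Suc q"
        by (intro always_eventually allI)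
      show "((\<lambda>h. \<bar>h\<bar> ^ Suc q) \<longlongrightarrow> (0::real)) (at 0)"
        by (auto intro!: tendsto_eq_intros)
    qed
    then show ?thesis using 3 assms by (simp add: DERIV_def q)
  qed
qed

lemma riesz_kernel_has_vector_derivative:
  assumes "p \<ge> 2" "x > 0"
  shows "(riesz_kernel p x s has_vector_derivative
           (- of_real (real p / x)) * riesz_kernel (p - 1) x s t + (- s) * riesz_kernel p x s t)
         (at t within S)"
proof -
  have "((\<lambda>t. max 0 (1 - t / x) ^ p) has_real_derivative
          real p * max 0 (1 - t / x) ^ (p - 1) * (- (1 / x))) (at t within S)"
    using assms
    by (intro DERIV_chain2[OF DERIV_max_0_power]) (auto intro!: derivative_eq_intros)
  then have "((\<lambda>t. of_real (max 0 (1 - t / x) ^ p) :: complex) has_vector_derivative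
          of_real (real p * max 0 (1 - t / x) ^ (p - 1) * (- (1 / x)))) (at t within S)"
    by (rule has_vector_derivative_of_real)
  moreover have "((\<lambda>t. exp (- of_real t * s)) has_vector_derivative
          (- s) * exp (- of_real t * s)) (at t within S)"
  proof -
    have "((\<lambda>z. exp (- z * s)) has_field_derivative (- s) * exp (- of_real t * s)) (at (of_real t))"
      by (auto intro!: derivative_eq_intros)
    moreover have "(of_real has_vector_derivative (1 :: complex)) (at t within S)"
      using has_vector_derivative_of_real[OF DERIV_ident] by simp
    ultimately have "(((\<lambda>z. exp (- z * s)) \<circ> of_real) has_vector_derivative
          1 * ((- s) * exp (- of_real t * s))) (at t within S)"
      by (intro field_vector_diff_chain_within[OF _ has_field_derivative_at_within])
    then show ?thesis by (simp add: o_def)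
  qed
  ultimately have "(riesz_kernel p x s has_vector_derivative
      of_real (max 0 (1 - t / x) ^ p) * ((- s) * exp (- of_real t * s)) +
      of_real (real p * max 0 (1 - t / x) ^ (p - 1) * (- (1 / x))) * exp (- of_real t * s))
      (at t within S)"
    unfolding riesz_kernel_def by (rule has_vector_derivative_mult)
  moreover have "of_real (max 0 (1 - t / x) ^ p) * ((- s) * exp (- of_real t * s)) +
      of_real (real p * max 0 (1 - t / x) ^ (p - 1) * (- (1 / x))) * exp (- of_real t * s) =
      (- of_real (real p / x)) * riesz_kernel (p - 1) x s t + (- s) * riesz_kernel p x s t"
    unfolding riesz_kernel_def of_real_mult of_real_minus of_real_divide of_real_1
    by (simp add: divide_inverse algebra_simps)
  ultimately show ?thesis by simp
qed

text \<open>
  Differentiation turns the kernel of order \<open>p\<close> into a combination of the kernels of orders \<open>p - 1\<close>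
  and \<open>p\<close> with coefficients at most \<open>p\<close> and \<open>norm s\<close>, so each derivative costs a factor
  \<open>p + norm s\<close>.  Starting from \<open>p > m\<close>, the order is at least \<open>2\<close> at each of the \<open>m\<close> steps.
\<close>
lemma deriv_bounded_riesz_kernel:
  assumes "m < p" "x \<ge> 1" "Re s \<ge> 0"
  shows "deriv_bounded m ((real p + norm s) ^ m) (riesz_kernel p x s)"
  using assms(1)
proof (induction m arbitrary: p)
  case 0
  show ?case using norm_riesz_kernel_le[of _ x s p] assms by simp
next
  case (Suc m)
  let ?A = "(real (p - 1) + norm s) ^ m" and ?B = "(real p + norm s) ^ m"
  let ?c = "- complex_of_real (real p / x)"
  have "deriv_bounded m (norm ?c * ?A + norm (- s) * ?B)
          (\<lambda>t. ?c * riesz_kernel (p - 1) x s t + (- s) * riesz_kernel p x s t)"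
    using Suc by (intro deriv_bounded_lincomb Suc.IH) auto
  moreover have "norm ?c * ?A + norm (- s) * ?B \<le> (real p + norm s) ^ Suc m"
  proof -
    have "norm ?c \<le> real p"
      using assms(2) by (simp add: norm_divide divide_le_eq mult_le_cancel_left1)
    moreover have "?A \<le> ?B" by (intro power_mono) auto
    ultimately have "norm ?c * ?A + norm (- s) * ?B \<le> real p * ?B + norm s * ?B"
      by (intro add_mono mult_mono) auto
    then show ?thesis by (simp add: algebra_simps)
  qed
  ultimately have "deriv_bounded m ((real p + norm s) ^ Suc m)
          (\<lambda>t. ?c * riesz_kernel (p - 1) x s t + (- s) * riesz_kernel p x s t)"
    by (rule deriv_bounded_mono)
  moreover have "(riesz_kernel p x s has_vector_derivative
      (?c * riesz_kernel (p - 1) x s t + (- s) * riesz_kernel p x s t)) (at t within {0..})" for t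
    using Suc.prems assms(2) by (intro riesz_kernel_has_vector_derivative) auto
  ultimately show ?case
    unfolding deriv_bounded.simps
    by (intro exI[of _ "\<lambda>t. ?c * riesz_kernel (p - 1) x s t + (- s) * riesz_kernel p x s t"]) simp
qed

section \<open>Frequencies and Riesz means\<close>

lemma frequency_less:
  assumes "frequency lam" "1 \<le> i" "i < j"
  shows "lam i < lam j"
  using assms unfolding frequency_def by (auto intro: strict_mono_onD)

lemma frequency_nonneg: "frequency lam \<Longrightarrow> 1 \<le> i \<Longrightarrow> 0 \<le> lam i"
  unfolding frequency_def by simp

lemma frequency_inj_on:
  assumes "frequency lam" "J \<subseteq> {1..}"
  shows "inj_on lam J"
proof -
  have "inj_on lam {1..}"
    using assms(1) strict_mono_on_imp_inj_on unfolding frequency_def by blast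
  then show ?thesis using assms(2) by (rule inj_on_subset)
qed

lemma finite_frequency_le:
  assumes "frequency lam"
  shows "finite {n. 1 \<le> n \<and> lam n \<le> x}"
proof -
  have "eventually (\<lambda>n. lam n > x) sequentially"
    using assms unfolding frequency_def filterlim_at_top_dense by blast
  then obtain N where "\<And>n. n \<ge> N \<Longrightarrow> lam n > x"
    by (auto simp: eventually_sequentially)
  then have "{n. 1 \<le> n \<and> lam n \<le> x} \<subseteq> {..<N}"
    by (auto simp: not_le[symmetric])
  then show ?thesis by (rule finite_subset) simp
qed

lemma riesz_mean_eq_sum_kernel:
  assumes "p \<ge> 1" "x > 0"
  shows "riesz_mean lam (real p) x a s =
           (\<Sum>n | 1 \<le> n \<and> lam n \<le> x. a n * riesz_kernel p x s (lam n))"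
  unfolding riesz_mean_def
proof (rule sum.cong)
  fix n assume n: "n \<in> {n. 1 \<le> n \<and> lam n \<le> x}"
  then have "0 \<le> 1 - lam n / x" using assms by (simp add: field_simps)
  then have "(if real p = 0 then 1 else (1 - lam n / x) powr real p) = max 0 (1 - lam n / x) ^ p"
    using assms by (simp add: powr_realpow')
  then show "a n * complex_of_real (if real p = 0 then 1 else (1 - lam n / x) powr real p) *
        exp (- complex_of_real (lam n) * s) = a n * riesz_kernel p x s (lam n)"
    unfolding riesz_kernel_def by simp
qed simp

text \<open>
  For finitely supported coefficients the range of summation does not depend on \<open>x\<close>: the kernel
  vanishes at frequencies beyond \<open>x\<close>.
\<close>
lemma riesz_mean_finite_support:
  assumes "frequency lam" "p \<ge> 1" "x > 0" "finite F" "F \<subseteq> {1..}" "\<And>i. i \<notin> F \<Longrightarrow> a i = 0"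
  shows "riesz_mean lam (real p) x a s = (\<Sum>i\<in>F. a i * riesz_kernel p x s (lam i))"
proof -
  have "(\<Sum>n | 1 \<le> n \<and> lam n \<le> x. a n * riesz_kernel p x s (lam n)) =
        (\<Sum>n | n \<in> F \<and> lam n \<le> x. a n * riesz_kernel p x s (lam n))"
    using assms(5,6) by (intro sum.mono_neutral_right finite_frequency_le[OF assms(1)]) auto
  also have "\<dots> = (\<Sum>i\<in>F. a i * riesz_kernel p x s (lam i))"
    using assms(2-4) by (intro sum.mono_neutral_left) (auto simp: riesz_kernel_def max_def field_simps)
  finally show ?thesis
    unfolding riesz_mean_eq_sum_kernel[OF assms(2,3)] .
qed

lemma riesz_kernel_tendsto:
  "((\<lambda>x. riesz_kernel p x s t) \<longlongrightarrow> exp (- of_real t * s)) at_top"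
proof -
  have "((\<lambda>x. t / x) \<longlongrightarrow> 0) at_top"
    by (rule real_tendsto_divide_at_top[OF tendsto_const filterlim_ident])
  then have "((\<lambda>x. riesz_kernel p x s t) \<longlongrightarrow> of_real (max 0 (1 - 0) ^ p) * exp (- of_real t * s)) at_top"
    unfolding riesz_kernel_def by (intro tendsto_intros tendsto_max) auto
  then show ?thesis by simp
qed

section \<open>Dirichlet polynomials with small Riesz means\<close>

text \<open>
  The Dirichlet polynomial that represents the error at \<open>lam n\<close> of interpolation at the nodes
  \<open>lam i\<close>, \<open>i \<in> J\<close>.
\<close>
definition block_coeff :: "(nat \<Rightarrow> real) \<Rightarrow> nat set \<Rightarrow> nat \<Rightarrow> nat \<Rightarrow> complex" where
  "block_coeff lam J n i =
     (if i = n then 1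
      else if i \<in> J then - of_real (lagrange_basis (lam ` J) (lam i) (lam n)) else 0)"

lemma sum_block_coeff:
  assumes "finite J" "n \<notin> J" "inj_on lam J"
  shows "(\<Sum>i\<in>insert n J. block_coeff lam J n i * g (lam i)) =
           g (lam n) - (\<Sum>t\<in>lam ` J. of_real (lagrange_basis (lam ` J) t (lam n)) * g t)"
proof -
  have "(\<Sum>i\<in>J. block_coeff lam J n i * g (lam i)) =
        (\<Sum>i\<in>J. - (of_real (lagrange_basis (lam ` J) (lam i) (lam n)) * g (lam i)))"
    using assms(2) by (intro sum.cong) (auto simp: block_coeff_def)
  then show ?thesis
    using assms by (simp add: sum.reindex block_coeff_def sum_negf)
qed

text \<open>
  The two bounds \<open>A\<close> and \<open>A * y ^ m\<close> meet at \<open>y = 1\<close>: \<open>y powr k\<close> is at least \<open>y ^ m\<close> to the left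
  of this point and at least \<open>1\<close> to the right.  This is how a non-integral growth exponent is
  reached from an integral number of nodes.
\<close>
lemma le_powr_interpolate:
  fixes y A N :: real
  assumes "0 < y" "0 \<le> k" "k \<le> real m" "0 \<le> A" "N \<le> A" "N \<le> A * y ^ m"
  shows "N \<le> A * y powr k"
proof (cases "y \<le> 1")
  case True
  then have "y ^ m \<le> y powr k"
    using assms powr_mono'[of k "real m" y] by (simp add: powr_realpow)
  then show ?thesis
    using assms by (meson mult_left_mono order_trans)
next
  case False
  then have "1 \<le> y powr k" using assms by (simp add: ge_one_powr_ge_zero)
  then have "A * 1 \<le> A * y powr k" using assms by (intro mult_left_mono) auto
  then show ?thesis using assms by simp
qed

text \<open>
  The central estimate.  The order \<open>Suc m\<close> of the mean makes the kernel just smooth enough for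
  \<open>m\<close> nodes, and the constant depends neither on \<open>n\<close> nor on \<open>x\<close>.
\<close>
lemma norm_riesz_mean_block_le:
  fixes \<epsilon> K k :: real
  assumes lam: "frequency lam" and n: "n \<ge> 1"
    and J: "finite J" "J \<subseteq> {1..}" "n \<notin> J"
    and eps: "0 < \<epsilon>" and K: "K \<ge> 1" and k: "0 \<le> k" "k \<le> real m"
    and cases: "J = {} \<and> \<epsilon> = 1 \<or> m \<ge> 1 \<and> card J = m"
    and near: "\<And>i. i \<in> J \<Longrightarrow> \<bar>lam i - lam n\<bar> \<le> K * \<epsilon>"
    and basis: "\<And>i. i \<in> J \<Longrightarrow> \<bar>lagrange_basis (lam ` J) (lam i) (lam n)\<bar> \<le> K"
    and x: "x \<ge> 1" and s: "Re s \<ge> 0"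
  shows "norm (riesz_mean lam (real (Suc m)) x (block_coeff lam J n) s) \<le>
           (1 + m * K) * (K * Suc m) powr k * \<epsilon> powr k * (1 + norm s) powr k"
proof -
  let ?g = "riesz_kernel (Suc m) x s" and ?T = "lam ` J"
  let ?N = "norm (riesz_mean lam (real (Suc m)) x (block_coeff lam J n) s)"
  define y where "y = K * Suc m * \<epsilon> * (1 + norm s)"
  have y0: "y > 0" unfolding y_def using eps K by (auto intro!: mult_pos_pos add_pos_nonneg)
  have T: "finite ?T" "?T \<subseteq> {0..}" "card ?T = card J"
    using J lam frequency_nonneg by (auto simp: card_image frequency_inj_on)
  have mean: "riesz_mean lam (real (Suc m)) x (block_coeff lam J n) s =
      ?g (lam n) - (\<Sum>t\<in>?T. of_real (lagrange_basis ?T t (lam n)) * ?g t)"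
    unfolding sum_block_coeff[OF J(1,3) frequency_inj_on[OF lam J(2)], symmetric]
    using J n x by (intro riesz_mean_finite_support lam) (auto simp: block_coeff_def)
  have g1: "norm (?g t) \<le> 1" if "t \<ge> 0" for t
    using norm_riesz_kernel_le[of t x s] that x s by simp
  have lam_n: "lam n \<ge> 0" using lam n by (rule frequency_nonneg)
  have "?N \<le> (1 + m * K) * y powr k"
    using cases
  proof (elim disjE conjE)
    assume "J = {}" "\<epsilon> = 1"
    then have "?N \<le> 1" unfolding mean using g1[OF lam_n] by simp
    moreover have "1 \<le> K * Suc m" using K mult_mono[of 1 K 1 "real (Suc m)"] by simp
    then have "1 \<le> y"
      unfolding y_def using \<open>\<epsilon> = 1\<close> mult_mono[of 1 "K * Suc m" 1 "1 + norm s"]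
      by (simp del: of_nat_Suc)
    then have "1 \<le> y powr k" using k by (simp add: ge_one_powr_ge_zero)
    then have "1 \<le> (1 + m * K) * y powr k"
      using K mult_mono[of 1 "1 + m * K" 1 "y powr k"] by simp
    ultimately show ?thesis by linarith
  next
    assume m: "m \<ge> 1" "card J = m"
    have sup_bound: "?N \<le> 1 + m * K"
    proof -
      have "?N \<le> norm (?g (lam n)) + (\<Sum>t\<in>?T. norm (of_real (lagrange_basis ?T t (lam n)) * ?g t))"
        unfolding mean by (intro order_trans[OF norm_triangle_ineq4] add_left_mono norm_sum)
      also have "\<dots> \<le> 1 + (\<Sum>t\<in>?T. K * 1)"
        using T(2) K basis lam_n unfolding norm_mult norm_of_real
        by (intro add_mono sum_mono mult_mono g1) auto
      finally show ?thesis using T m by simp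
    qed
    have "?N \<le> m * K * (K * \<epsilon>) ^ m * (real (Suc m) + norm s) ^ m"
    proof -
      have "?T \<noteq> {}" using m by auto
      moreover have "deriv_bounded (card ?T) ((real (Suc m) + norm s) ^ m) ?g"
        unfolding T m by (intro deriv_bounded_riesz_kernel x s) simp
      ultimately show ?thesis
        using interpolation_error_bound[of ?T "lam n" "(real (Suc m) + norm s) ^ m" ?g "K * \<epsilon>" K]
          T m near basis lam_n unfolding mean by auto
    qed
    also have "\<dots> \<le> m * K * (K * \<epsilon>) ^ m * (Suc m * (1 + norm s)) ^ m"
      using K eps by (intro mult_left_mono power_mono) (auto simp: algebra_simps)
    also have "\<dots> = m * K * y ^ m"
      unfolding y_def by (simp only: power_mult_distrib mult_ac)
    also have "\<dots> \<le> (1 + m * K) * y ^ m"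
      using y0 by (intro mult_right_mono) auto
    finally show ?thesis
      using y0 k K sup_bound by (intro le_powr_interpolate[of y k m]) auto
  qed
  also have "y powr k = (K * Suc m) powr k * \<epsilon> powr k * (1 + norm s) powr k"
    unfolding y_def using K eps by (simp add: powr_mult)
  finally show ?thesis by (simp add: mult_ac)
qed

section \<open>Series of Dirichlet polynomials\<close>

text \<open>
  Letting \<open>x\<close> tend to infinity in the bound for the Riesz means of the polynomials bounds the
  polynomials themselves.  Both the convergence of the means of the series and the
  holomorphy of its limit then follow by domination with a geometric series.  The requirement that
  the \<open>j\<close>-th polynomial starts at an index \<open>\<ge> j\<close> makes every coefficient of the series a finite sum.
\<close>
lemma dominated_series_in_dirichlet_ext:
  fixes lam :: "nat \<Rightarrow> real" and p :: nat and b :: "nat \<Rightarrow> nat \<Rightarrow> complex"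
  assumes lam: "frequency lam" and p: "p \<ge> 1"
    and F: "\<And>j. finite (F j)" "\<And>j. F j \<subseteq> {1..}" "\<And>i j. i \<in> F j \<Longrightarrow> j \<le> i"
    and supp: "\<And>i j. i \<notin> F j \<Longrightarrow> b j i = 0"
    and bound: "\<And>j x s. x \<ge> 1 \<Longrightarrow> Re s \<ge> 0 \<Longrightarrow>
                  norm (riesz_mean lam (real p) x (b j) s) \<le> C * (1 + norm s) powr k"
  shows "(\<lambda>i. \<Sum>j\<le>i. (1/2) ^ j * b j i) \<in> dirichlet_ext lam k"
proof -
  define a where "a i = (\<Sum>j\<le>i. (1/2) ^ j * b j i)" for i
  define P where "P j s = (\<Sum>i\<in>F j. b j i * exp (- of_real (lam i) * s))" for j s
  define f where "f s = (\<Sum>j. (1/2) ^ j * P j s)" for s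
  let ?R = "\<lambda>x. riesz_mean lam (real p) x"
  have P_lim: "((\<lambda>x. ?R x (b j) s) \<longlongrightarrow> P j s) at_top" for j s
  proof -
    have "((\<lambda>x. \<Sum>i\<in>F j. b j i * riesz_kernel p x s (lam i)) \<longlongrightarrow> P j s) at_top"
      unfolding P_def by (intro tendsto_intros riesz_kernel_tendsto)
    moreover have "eventually (\<lambda>x. (\<Sum>i\<in>F j. b j i * riesz_kernel p x s (lam i)) = ?R x (b j) s) at_top"
      using eventually_gt_at_top[of 0]
      by eventually_elim (intro riesz_mean_finite_support[symmetric] lam p F supp)
    ultimately show ?thesis by (rule Lim_transform_eventually)
  qed
  have P_bound: "norm (P j s) \<le> C * (1 + norm s) powr k" if "Re s \<ge> 0" for j s
    using tendsto_norm[OF P_lim[of j s]]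
  proof (rule tendsto_upperbound)
    show "eventually (\<lambda>x. norm (?R x (b j) s) \<le> C * (1 + norm s) powr k) at_top"
      using eventually_ge_at_top[of 1] by eventually_elim (intro bound that)
  qed simp
  have C0: "C \<ge> 0" using order_trans[OF norm_ge_zero P_bound[of 0]] by simp
  have term_bound: "norm ((1/2) ^ j * P j s) \<le> (1/2) ^ j * M"
    if "Re s \<ge> 0" "C * (1 + norm s) powr k \<le> M" for j s M
    using P_bound[OF that(1), of j] that(2) by (simp add: norm_mult norm_power norm_divide divide_right_mono)
  have geom: "summable (\<lambda>j. (1/2) ^ j * M :: real)" for M
    by (intro summable_mult2 summable_geometric) simp
  have mean_a: "?R x a s = (\<Sum>j. (1/2) ^ j * ?R x (b j) s)" for x s
  proof -
    let ?S = "{n. 1 \<le> n \<and> lam n \<le> x}"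
    define w where "w n = complex_of_real (if real p = 0 then 1 else (1 - lam n / x) powr real p) *
        exp (- complex_of_real (lam n) * s)" for n
    have R: "?R x c s = (\<Sum>n\<in>?S. c n * w n)" for c
      unfolding riesz_mean_def w_def by (simp add: mult.assoc)
    \<comment> \<open>For fixed \<open>x\<close> only finitely many coefficients, hence finitely many polynomials, enter the mean.\<close>
    obtain N where N: "\<And>n. n \<in> ?S \<Longrightarrow> n \<le> N"
      using finite_frequency_le[OF lam, of x] unfolding finite_nat_set_iff_bounded_le by blast
    have b0: "b j i = 0" if "i < j" for i j
      using supp[of i j] F(3)[of i j] that by fastforce
    have "a n = (\<Sum>j\<le>N. (1/2) ^ j * b j n)" if "n \<in> ?S" for n
      unfolding a_def using N[OF that] b0 by (intro sum.mono_neutral_left) auto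
    then have "?R x a s = (\<Sum>n\<in>?S. \<Sum>j\<le>N. (1/2) ^ j * b j n * w n)"
      unfolding R by (intro sum.cong) (auto simp: sum_distrib_right)
    also have "\<dots> = (\<Sum>j\<le>N. (1/2) ^ j * ?R x (b j) s)"
      unfolding R by (subst sum.swap) (simp add: sum_distrib_left mult.assoc)
    also have "\<dots> = (\<Sum>j. (1/2) ^ j * ?R x (b j) s)"
    proof (rule suminf_finite[symmetric])
      fix j assume "j \<notin> {..N}"
      then have "b j n = 0" if "n \<in> ?S" for n
        using b0 N[OF that] by auto
      then have "?R x (b j) s = 0"
        unfolding R by (intro sum.neutral) auto
      then show "(1/2) ^ j * ?R x (b j) s = 0" by simp
    qed simp
    finally show ?thesis .
  qed
  have lim: "((\<lambda>x. ?R x a s) \<longlongrightarrow> f s) at_top" if s: "Re s \<ge> 0" for s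
  proof -
    let ?M = "\<lambda>j. (1/2) ^ j * (C * (1 + norm s) powr k)"
    have termwise: "((\<lambda>x. (1/2) ^ j * ?R x (b j) s) \<longlongrightarrow> (1/2) ^ j * P j s) at_top" for j
      by (intro tendsto_intros P_lim)
    have "eventually (\<lambda>(j, x). norm ((1/2) ^ j * ?R x (b j) s) \<le> ?M j)
                     (sequentially \<times>\<^sub>F at_top)"
      by (rule eventually_mono[OF eventually_prodI[OF eventually_True eventually_ge_at_top[of 1]]])
         (auto simp: norm_mult norm_power norm_divide intro!: divide_right_mono bound s)
    from tannerys_theorem[OF termwise this geom] show ?thesis
      unfolding mean_a f_def by simp
  qed
  have f_bound: "norm (f s) \<le> 2 * C * (1 + norm s) powr k" if s: "Re s \<ge> 0" for s
  proof -
    have "norm (f s) \<le> (\<Sum>j. (1/2) ^ j * (C * (1 + norm s) powr k))"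
      unfolding f_def by (intro norm_suminf_le term_bound s geom order.refl)
    also have "\<dots> = 2 * (C * (1 + norm s) powr k)"
      by (subst suminf_mult2[symmetric]) (simp_all add: suminf_geometric)
    finally show ?thesis by simp
  qed
  have f_hol: "f holomorphic_on {s. 0 < Re s}"
  proof (rule holomorphic_uniform_sequence)
    show open_half: "open {s. 0 < Re s}" by (rule open_halfspace_Re_gt)
    show "(\<lambda>s. \<Sum>j<n. (1/2) ^ j * P j s) holomorphic_on {s. 0 < Re s}" for n
      unfolding P_def by (intro holomorphic_intros)
    fix z :: complex assume "z \<in> {s. 0 < Re s}"
    then obtain d where d: "d > 0" "cball z d \<subseteq> {s. 0 < Re s}"
      using open_half open_contains_cball by blast
    have "\<exists>M. \<forall>s\<in>cball z d. C * (1 + norm s) powr k \<le> M"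
    proof -
      have "continuous_on (cball z d) (\<lambda>s. C * (1 + norm s) powr k)"
        by (intro continuous_intros ballI) (metis add_pos_nonneg less_irrefl norm_ge_zero zero_less_one)
      then have "bounded ((\<lambda>s. C * (1 + norm s) powr k) ` cball z d)"
        by (intro compact_imp_bounded compact_continuous_image) auto
      then obtain M where "\<And>s. s \<in> cball z d \<Longrightarrow> \<bar>C * (1 + norm s) powr k\<bar> \<le> M"
        unfolding bounded_real by blast
      then show ?thesis by (meson abs_le_D1)
    qed
    then obtain M where M: "\<And>s. s \<in> cball z d \<Longrightarrow> C * (1 + norm s) powr k \<le> M" by blast
    have "uniform_limit (cball z d) (\<lambda>n s. \<Sum>j<n. (1/2) ^ j * P j s) f sequentially"
      unfolding f_def
    proof (rule Weierstrass_m_test[OF _ geom])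
      fix j s assume "s \<in> cball z d"
      then show "norm ((1/2) ^ j * P j s) \<le> (1/2) ^ j * M"
        using d(2) by (intro term_bound M) auto
    qed
    with d show "\<exists>d>0. cball z d \<subseteq> {s. 0 < Re s} \<and>
        uniform_limit (cball z d) (\<lambda>n s. \<Sum>j<n. (1/2) ^ j * P j s) f sequentially"
      by blast
  qed
  have "riesz_summable lam (real p) a (complex_of_real 0)"
    unfolding riesz_summable_def using lim[of 0] by auto
  then have "riesz_abscissa lam (real p) a \<le> ereal 0"
    unfolding riesz_abscissa_def by (intro Inf_lower) auto
  then have "riesz_abscissa lam (real p) a < \<infinity>"
    by (rule le_less_trans) simp
  moreover have "bdd_above ((\<lambda>s. norm (f s) / (1 + norm s) powr k) ` {s. 0 < Re s})"
  proof (rule bdd_aboveI2)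
    fix s assume "s \<in> {s. 0 < Re s}"
    moreover have "(1 + norm s) powr k > 0"
      by (metis add_pos_nonneg norm_ge_zero powr_gt_zero zero_less_one less_irrefl)
    ultimately show "norm (f s) / (1 + norm s) powr k \<le> 2 * C"
      using f_bound[of s] by (simp add: pos_divide_le_eq)
  qed
  ultimately have "a \<in> dirichlet_ext lam k"
    unfolding dirichlet_ext_def using f_hol lim
    by (intro CollectI exI[of _ "real p"] conjI exI[of _ f]) auto
  then show ?thesis unfolding a_def .
qed

section \<open>Choice of the nodes\<close>

lemma freq_gap_eq: "n \<ge> 2 \<Longrightarrow> freq_gap lam n = min 1 (min (lam n - lam (n - 1)) (lam (n + 1) - lam n))"
  unfolding freq_gap_def by simp

lemma freq_gap_pos:
  assumes "frequency lam" "n \<ge> 2"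
  shows "freq_gap lam n > 0"
  using frequency_less[OF assms(1), of "n - 1" n] frequency_less[OF assms(1), of n "n + 1"] assms(2)
  by (simp add: freq_gap_eq)

text \<open>
  The nodes must be close to \<open>lam n\<close> on the scale of the gap and have bounded Lagrange coefficients.
  The empty set is admissible when the gap is \<open>1\<close>, where no cancellation is needed: the neighbouring
  frequencies may then be arbitrarily far away.
\<close>
definition admissible_nodes :: "(nat \<Rightarrow> real) \<Rightarrow> nat \<Rightarrow> real \<Rightarrow> nat \<Rightarrow> nat set \<Rightarrow> bool" where
  "admissible_nodes lam m K n J \<longleftrightarrow>
     J \<subseteq> {n - 1..n + m} - {n} \<and>
     (J = {} \<and> freq_gap lam n = 1 \<or> m \<ge> 1 \<and> card J = m) \<and>
     (\<forall>i\<in>J. \<bar>lam i - lam n\<bar> \<le> K * freq_gap lam n) \<and>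
     (\<forall>i\<in>J. \<bar>lagrange_basis (lam ` J) (lam i) (lam n)\<bar> \<le> K)"

text \<open>
  With a single node the Lagrange coefficient is an empty product, so it is bounded however
  irregular the gaps are.  This is what makes \<open>k \<le> 1\<close> special.
\<close>
lemma admissible_nodes_neighbour:
  assumes "frequency lam" "n \<ge> 2"
  shows "\<exists>J. admissible_nodes lam 1 1 n J"
proof -
  have single: "admissible_nodes lam 1 1 n {i}" if "i \<in> {n - 1, n + 1}" "\<bar>lam i - lam n\<bar> = freq_gap lam n" for i
    using that assms(2) unfolding admissible_nodes_def lagrange_basis_def by auto
  have "lam (n - 1) < lam n" "lam n < lam (n + 1)"
    using assms by (auto intro: frequency_less)
  then consider "freq_gap lam n = 1" | "\<bar>lam (n - 1) - lam n\<bar> = freq_gap lam n"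
    | "\<bar>lam (n + 1) - lam n\<bar> = freq_gap lam n"
    using freq_gap_eq[OF assms(2), of lam] by linarith
  then show ?thesis
  proof cases
    case 1
    then have "admissible_nodes lam 1 1 n {}" unfolding admissible_nodes_def by simp
    then show ?thesis ..
  next
    case 2
    then show ?thesis using single[of "n - 1"] by auto
  next
    case 3
    then show ?thesis using single[of "n + 1"] by auto
  qed
qed

lemma abs_lagrange_basis_le:
  assumes "finite T" "t \<in> T" "\<And>u. u \<in> T - {t} \<Longrightarrow> \<bar>x - u\<bar> \<le> q * \<bar>t - u\<bar>" "q \<ge> 1"
  shows "\<bar>lagrange_basis T t x\<bar> \<le> q ^ card T"
proof -
  have "\<bar>lagrange_basis T t x\<bar> = (\<Prod>u\<in>T - {t}. \<bar>(x - u) / (t - u)\<bar>)"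
    unfolding lagrange_basis_def abs_prod ..
  also have "\<dots> \<le> (\<Prod>u\<in>T - {t}. q)"
    using assms(3) by (intro prod_mono) (auto simp: abs_divide divide_le_eq)
  also have "\<dots> \<le> q ^ card T"
    using assms by (simp add: power_increasing)
  finally show ?thesis .
qed

text \<open>
  Unless the gap is \<open>1\<close>, the nodes are the next \<open>m\<close> frequencies.  Comparability of consecutive gaps makes all gaps between
  \<open>lam n\<close> and \<open>lam (n + m)\<close>, as well as \<open>freq_gap lam n\<close>, comparable to
  \<open>lam (n + 1) - lam n\<close>.  In the constant, one factor \<open>C ^ m\<close> bounds
  distances to \<open>lam n\<close> from above, the other separates the nodes from each other, the remaining \<open>C\<close>
  passes from \<open>lam (n + 1) - lam n\<close> to the minimal gap, and the outer power comes from
  the product defining the Lagrange coefficients.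
\<close>
lemma admissible_nodes_comparable_gaps:
  fixes C :: real
  assumes lam: "frequency lam" and C: "C \<ge> 1" and m: "m \<ge> 1" and n: "n \<ge> 2"
    and up: "\<And>i. i \<ge> 2 \<Longrightarrow> lam (i + 1) - lam i \<le> C * (lam i - lam (i - 1))"
    and down: "\<And>i. i \<ge> 2 \<Longrightarrow> lam i - lam (i - 1) \<le> C * (lam (i + 1) - lam i)"
  shows "\<exists>J. admissible_nodes lam m ((m * C ^ (2 * m + 1)) ^ m) n J"
proof -
  define d where "d i = lam (i + 1) - lam i" for i
  define q where "q = m * C ^ (2 * m + 1)"
  have C_pow: "1 \<le> C ^ i" for i using C by (rule one_le_power)
  have q1: "q \<ge> 1"
    unfolding q_def using m C_pow[of "2 * m + 1"] mult_mono[of 1 "real m" 1 "C ^ (2 * m + 1)"] by simp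
  then have q_le: "q \<le> q ^ m" using m by (simp add: self_le_power)
  have d_pos: "d i > 0" if "i \<ge> 1" for i
    unfolding d_def using frequency_less[OF lam, of i "i + 1"] that by simp
  have step: "d (Suc i) \<le> C * d i" "d i \<le> C * d (Suc i)" if "i \<ge> 1" for i
    using up[of "Suc i"] down[of "Suc i"] that unfolding d_def by simp_all
  have d_near: "d (n + i) \<le> C ^ i * d n \<and> d n \<le> C ^ i * d (n + i)" for i
  proof (induction i)
    case (Suc i)
    have "d (n + Suc i) \<le> C * d (n + i)" "d (n + i) \<le> C * d (n + Suc i)"
      using step[of "n + i"] n by auto
    moreover have "C * d (n + i) \<le> C * (C ^ i * d n)"
      using Suc C by (intro mult_left_mono) auto
    moreover have "C ^ i * d (n + i) \<le> C ^ i * (C * d (n + Suc i))"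
      using \<open>d (n + i) \<le> C * d (n + Suc i)\<close> C by (intro mult_left_mono) auto
    ultimately show ?case using Suc by (auto simp: mult_ac)
  qed simp
  have d_le: "d (n + i) \<le> C ^ m * d n" "d n \<le> C ^ m * d (n + i)" if "i \<le> m" for i
  proof -
    have "C ^ i \<le> C ^ m" using that C by (intro power_increasing) auto
    then have "C ^ i * d n \<le> C ^ m * d n" "C ^ i * d (n + i) \<le> C ^ m * d (n + i)"
      using d_pos[of n] d_pos[of "n + i"] n by (auto intro!: mult_right_mono)
    then show "d (n + i) \<le> C ^ m * d n" "d n \<le> C ^ m * d (n + i)"
      using d_near[of i] by linarith+
  qed
  have far: "\<bar>lam i - lam n\<bar> \<le> m * C ^ m * d n" if i_mem: "i \<in> {n + 1..n + m}" for i
  proof -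
    obtain j where i: "i = n + j" "1 \<le> j" "j \<le> m"
      using i_mem by (intro that[of "i - n"]) auto
    have "lam (n + j) - lam n = (\<Sum>i<j. d (n + i))"
      unfolding d_def using sum_lessThan_telescope[of "\<lambda>i. lam (n + i)" j] by simp
    also have "\<dots> \<le> (\<Sum>i<j. C ^ m * d n)"
      using i by (intro sum_mono d_le) auto
    also have "\<dots> \<le> m * C ^ m * d n"
      using i d_pos[of n] n C by (auto intro!: mult_right_mono)
    finally show ?thesis using frequency_less[OF lam, of n i] i n by simp
  qed
  have sep: "d n \<le> C ^ m * (lam j - lam i)" if "n \<le> i" "i < j" "j \<le> n + m" for i j
  proof -
    have "lam (i + 1) \<le> lam j"
      using frequency_less[OF lam, of "i + 1" j] that by (cases "Suc i = j") auto
    then have "C ^ m * d i \<le> C ^ m * (lam j - lam i)"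
      unfolding d_def using C by (intro mult_left_mono) auto
    moreover have "d n \<le> C ^ m * d i"
      using d_le(2)[of "i - n"] that by simp
    ultimately show ?thesis by linarith
  qed
  have "\<exists>J. admissible_nodes lam m (q ^ m) n J"
  proof (cases "freq_gap lam n = 1")
    case True
    then have "admissible_nodes lam m (q ^ m) n {}" unfolding admissible_nodes_def by simp
    then show ?thesis ..
  next
    case False
    let ?J = "{n + 1..n + m}"
    have inj: "inj_on lam ?J" by (rule frequency_inj_on[OF lam]) auto
    \<comment> \<open>The minimal gap is one of the two gaps next to \<open>lam n\<close>, and both are comparable to \<open>d n\<close>.\<close>
    have "d n \<le> C * freq_gap lam n"
    proof -
      have "d n \<le> C * d (n - 1)" using step(1)[of "n - 1"] n by simp
      moreover have "d n \<le> C * d n" using C d_pos[of n] n by simp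
      moreover have "freq_gap lam n = d n \<or> freq_gap lam n = d (n - 1)"
        using False freq_gap_eq[OF n, of lam] n unfolding d_def by (auto simp: min_def split: if_splits)
      ultimately show ?thesis by auto
    qed
    then have "m * C ^ m * d n \<le> m * C ^ m * (C * freq_gap lam n)"
      using C by (intro mult_left_mono) auto
    also have "\<dots> \<le> q * freq_gap lam n"
    proof -
      have "C ^ (m + 1) \<le> C ^ (2 * m + 1)" using C by (intro power_increasing) auto
      then have "m * C ^ (m + 1) * freq_gap lam n \<le> q * freq_gap lam n"
        unfolding q_def using freq_gap_pos[OF lam n] by (intro mult_right_mono mult_left_mono) auto
      then show ?thesis by (simp add: mult_ac)
    qed
    also have "\<dots> \<le> q ^ m * freq_gap lam n"
      using q_le freq_gap_pos[OF lam n] by (intro mult_right_mono) auto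
    finally have near: "\<bar>lam i - lam n\<bar> \<le> q ^ m * freq_gap lam n" if "i \<in> ?J" for i
      using far[OF that] by linarith
    have "\<bar>lam n - lam i\<bar> \<le> q * \<bar>lam j - lam i\<bar>" if "i \<in> ?J" "j \<in> ?J" "i \<noteq> j" for i j
    proof -
      have "\<bar>lam n - lam i\<bar> \<le> m * C ^ m * d n"
        using far[OF that(1)] by linarith
      also have "d n \<le> C ^ m * \<bar>lam j - lam i\<bar>"
      proof (cases "i < j")
        case True
        then show ?thesis
          using sep[of i j] that frequency_less[OF lam, of i j] by auto
      next
        case False
        then show ?thesis
          using sep[of j i] that frequency_less[OF lam, of j i] by auto
      qed
      then have "m * C ^ m * d n \<le> m * C ^ m * (C ^ m * \<bar>lam j - lam i\<bar>)"
        using C by (intro mult_left_mono) auto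
      also have "\<dots> = m * C ^ (2 * m) * \<bar>lam j - lam i\<bar>"
        by (simp add: mult_2 power_add)
      also have "\<dots> \<le> q * \<bar>lam j - lam i\<bar>"
        unfolding q_def using C by (intro mult_right_mono mult_left_mono power_increasing) auto
      finally show ?thesis .
    qed
    then have ratio: "\<bar>lam n - u\<bar> \<le> q * \<bar>lam j - u\<bar>" if "j \<in> ?J" "u \<in> lam ` ?J - {lam j}" for j u
      using that by blast
    have "\<bar>lagrange_basis (lam ` ?J) (lam j) (lam n)\<bar> \<le> q ^ card (lam ` ?J)" if "j \<in> ?J" for j
      using that q1 by (intro abs_lagrange_basis_le ratio) auto
    then have "admissible_nodes lam m (q ^ m) n ?J"
      unfolding admissible_nodes_def using near m card_image[OF inj] by auto
    then show ?thesis ..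
  qed
  then show ?thesis unfolding q_def .
qed

lemma exists_admissible_nodes:
  fixes k :: real
  assumes lam: "frequency lam" and k: "k \<ge> 0"
    and cases: "k \<le> 1 \<or>
         (\<exists>c1>0. \<exists>c2>0. \<forall>n\<ge>2.
            c1 \<le> (lam (n + 1) - lam n) / (lam n - lam (n - 1)) \<and>
            (lam (n + 1) - lam n) / (lam n - lam (n - 1)) \<le> c2)"
  obtains m :: nat and K :: real and J where "k \<le> m" "K \<ge> 1" "\<And>n. n \<ge> 2 \<Longrightarrow> admissible_nodes lam m K n (J n)"
proof -
  have "\<exists>(m::nat) (K::real). k \<le> m \<and> K \<ge> 1 \<and> (\<forall>n\<ge>2. \<exists>J. admissible_nodes lam m K n J)"
    using cases
  proof
    assume "k \<le> 1"
    then show ?thesis using admissible_nodes_neighbour[OF lam] by (intro exI[of _ 1]) auto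
  next
    assume "\<exists>c1>0. \<exists>c2>0. \<forall>n\<ge>2.
            c1 \<le> (lam (n + 1) - lam n) / (lam n - lam (n - 1)) \<and>
            (lam (n + 1) - lam n) / (lam n - lam (n - 1)) \<le> c2"
    then obtain c1 c2 :: real where c: "c1 > 0" "c2 > 0"
      and ratio: "\<And>n. n \<ge> 2 \<Longrightarrow> c1 \<le> (lam (n + 1) - lam n) / (lam n - lam (n - 1))"
        "\<And>n. n \<ge> 2 \<Longrightarrow> (lam (n + 1) - lam n) / (lam n - lam (n - 1)) \<le> c2"
      by blast
    define C where "C = max 1 (max c2 (1 / c1))"
    \<comment> \<open>The successor keeps the number of nodes positive even for \<open>k = 0\<close>.\<close>
    define m where "m = nat \<lceil>k\<rceil> + 1"
    have C: "C \<ge> 1" "c2 \<le> C" "1 \<le> C * c1"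
    proof -
      have "1 / c1 \<le> C" unfolding C_def by simp
      then show "1 \<le> C * c1" using c(1) by (simp add: divide_le_eq)
    qed (auto simp: C_def)
    have gaps: "lam (n + 1) - lam n \<le> C * (lam n - lam (n - 1))"
               "lam n - lam (n - 1) \<le> C * (lam (n + 1) - lam n)" if n: "n \<ge> 2" for n
    proof -
      have pos: "lam n - lam (n - 1) > 0" using frequency_less[OF lam, of "n - 1" n] n by simp
      then have le: "lam (n + 1) - lam n \<le> c2 * (lam n - lam (n - 1))"
        "c1 * (lam n - lam (n - 1)) \<le> lam (n + 1) - lam n"
        using ratio[OF n] by (simp_all only: pos_divide_le_eq pos_le_divide_eq)
      have "c2 * (lam n - lam (n - 1)) \<le> C * (lam n - lam (n - 1))"
        using C(2) pos by (intro mult_right_mono) auto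
      with le(1) show "lam (n + 1) - lam n \<le> C * (lam n - lam (n - 1))" by linarith
      have "1 * (lam n - lam (n - 1)) \<le> C * c1 * (lam n - lam (n - 1))"
        using C(3) pos by (intro mult_right_mono) auto
      also have "\<dots> = C * (c1 * (lam n - lam (n - 1)))" by simp
      also have "\<dots> \<le> C * (lam (n + 1) - lam n)"
        using le(2) C(1) by (intro mult_left_mono) auto
      finally show "lam n - lam (n - 1) \<le> C * (lam (n + 1) - lam n)" by simp
    qed
    have "m \<ge> 1" "k \<le> m" unfolding m_def by (auto, linarith)
    moreover have "1 \<le> (m * C ^ (2 * m + 1)) ^ m"
      using \<open>m \<ge> 1\<close> one_le_power[OF C(1), of "2 * m + 1"] mult_mono[of 1 "real m" 1 "C ^ (2 * m + 1)"]
      by (intro one_le_power) simp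
    ultimately show ?thesis
      using admissible_nodes_comparable_gaps[OF lam C(1) _ _ gaps] by blast
  qed
  then show ?thesis using that by metis
qed

section \<open>Gliding hump\<close>

text \<open>
  The factor \<open>4 ^ j\<close> leaves a factor \<open>2 ^ j\<close> after the weight \<open>2 ^ (- j)\<close> has made the series of humps
  converge, and the distances \<open>L\<close> keep the humps disjoint.
\<close>
lemma not_bigo_sparse_witnesses:
  fixes g \<rho> :: "nat \<Rightarrow> real"
  assumes "g \<notin> O(\<rho>)"
  obtains r where "\<And>j. r j \<ge> j + 2" "\<And>i j. i < j \<Longrightarrow> r i + L < r j" "\<And>j. \<bar>g (r j)\<bar> > 4 ^ j * \<bar>\<rho> (r j)\<bar>"
proof -
  have large: "\<exists>n\<ge>N. \<bar>g n\<bar> > c * \<bar>\<rho> n\<bar>" for N and c :: real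
  proof (rule ccontr)
    assume "\<not> ?thesis"
    then have "eventually (\<lambda>n. norm (g n) \<le> c * norm (\<rho> n)) sequentially"
      by (auto simp: eventually_sequentially not_less)
    then show False using assms bigoI by blast
  qed
  have "\<exists>r. \<forall>j. (r j \<ge> j + 2 \<and> \<bar>g (r j)\<bar> > 4 ^ j * \<bar>\<rho> (r j)\<bar>) \<and> r j + L < r (Suc j)"
  proof (rule dependent_nat_choice)
    show "\<exists>n. n \<ge> 0 + 2 \<and> \<bar>g n\<bar> > 4 ^ 0 * \<bar>\<rho> n\<bar>" using large[of "0 + 2" "4 ^ 0"] .
    fix x j
    obtain y where "y \<ge> Suc j + 2 + x + L + 1" "\<bar>g y\<bar> > 4 ^ Suc j * \<bar>\<rho> y\<bar>"
      using large by blast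
    then show "\<exists>y. (y \<ge> Suc j + 2 \<and> \<bar>g y\<bar> > 4 ^ Suc j * \<bar>\<rho> y\<bar>) \<and> x + L < y"
      by (intro exI[of _ y]) simp
  qed
  then obtain r where r: "\<And>j. r j \<ge> j + 2" "\<And>j. \<bar>g (r j)\<bar> > 4 ^ j * \<bar>\<rho> (r j)\<bar>" "\<And>j. r j + L < r (Suc j)"
    by blast
  have "r i + L < r j" if "i < j" for i j
    using that
  proof (induction j)
    case (Suc j)
    then show ?case using r(3)[of j] by (cases "i = j") auto
  qed simp
  with r show ?thesis using that by blast
qed

theorem theorem5p3:
  fixes lam :: "nat \<Rightarrow> real" and k :: real and \<rho> :: "nat \<Rightarrow> real"
  assumes "frequency lam"
    and "k \<ge> 0"
    and "k \<le> 1 \<or>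
         (\<exists>c1>0. \<exists>c2>0. \<forall>n\<ge>2.
            c1 \<le> (lam (n + 1) - lam n) / (lam n - lam (n - 1)) \<and>
            (lam (n + 1) - lam n) / (lam n - lam (n - 1)) \<le> c2)"
    and "\<And>n. n \<ge> 1 \<Longrightarrow> \<rho> n > 0"
    and "\<And>a. a \<in> dirichlet_ext lam k \<Longrightarrow> (\<lambda>n. norm (a n)) \<in> O(\<rho>)"
  shows "(\<lambda>n. (1 / freq_gap lam n) powr k) \<in> O(\<rho>)"
proof (rule ccontr)
  define g where "g n = (1 / freq_gap lam n) powr k" for n
  assume "(\<lambda>n. (1 / freq_gap lam n) powr k) \<notin> O(\<rho>)"
  then have not_bigo: "g \<notin> O(\<rho>)" by (simp add: g_def[abs_def])
  obtain m :: nat and K :: real and J where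
    m: "k \<le> m" and K: "K \<ge> 1" and J: "\<And>n. n \<ge> 2 \<Longrightarrow> admissible_nodes lam m K n (J n)"
    using exists_admissible_nodes[OF assms(1-3)] by metis
  obtain r where
    r: "\<And>j. r j \<ge> j + 2" "\<And>i j. i < j \<Longrightarrow> r i + Suc m < r j"
       "\<And>j. \<bar>g (r j)\<bar> > 4 ^ j * \<bar>\<rho> (r j)\<bar>"
    using not_bigo_sparse_witnesses[OF not_bigo, of "Suc m"] by blast
  have r2: "r j \<ge> 2" for j using r(1)[of j] by simp
  \<comment> \<open>The hump at \<open>r j\<close> occupies the indices from \<open>r j - 1\<close>, the left neighbour possibly used for \<open>k \<le> 1\<close>, to \<open>r j + m\<close>.\<close>
  define b where "b j i = of_real (g (r j)) * block_coeff lam (J (r j)) (r j) i" for j i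
  define a where "a i = (\<Sum>j\<le>i. (1/2) ^ j * b j i)" for i
  define C where "C = (1 + m * K) * (K * Suc m) powr k"
  have J_sub: "J (r j) \<subseteq> {r j - 1..r j + m} - {r j}" for j
    using J[OF r2[of j]] unfolding admissible_nodes_def by blast
  have supp: "b j i = 0" if "i \<notin> {r j - 1..r j + m}" for i j
    using that J_sub[of j] unfolding b_def block_coeff_def by auto
  have "(\<lambda>i. \<Sum>j\<le>i. (1/2) ^ j * b j i) \<in> dirichlet_ext lam k"
  proof (rule dominated_series_in_dirichlet_ext[where p = "Suc m" and C = C and F = "\<lambda>j. {r j - 1..r j + m}"])
    show "{r j - 1..r j + m} \<subseteq> {1..}" for j using r2[of j] by auto
    show "j \<le> i" if "i \<in> {r j - 1..r j + m}" for i j using that r(1)[of j] by auto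
    fix j :: nat and x :: real and s :: complex assume xs: "x \<ge> 1" "Re s \<ge> 0"
    let ?n = "r j"
    let ?R = "riesz_mean lam (real (Suc m)) x (block_coeff lam (J ?n) ?n) s"
    note nodes = J[OF r2[of j], unfolded admissible_nodes_def]
    have gap: "freq_gap lam ?n > 0" using assms(1) r2 by (rule freq_gap_pos)
    have R: "norm ?R \<le> C * freq_gap lam ?n powr k * (1 + norm s) powr k"
      unfolding C_def
    proof (rule norm_riesz_mean_block_le)
      show "finite (J ?n)" using J_sub by (rule finite_subset) simp
      show "J ?n \<subseteq> {1..}" using J_sub[of j] r2[of j] by auto
    qed (use assms(1,2) nodes r2[of j] gap K m xs in auto)
    have "riesz_mean lam (real (Suc m)) x (b j) s = of_real (g ?n) * ?R"
      unfolding riesz_mean_def b_def by (simp add: sum_distrib_left mult_ac)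
    then have "norm (riesz_mean lam (real (Suc m)) x (b j) s) = g ?n * norm ?R"
      by (simp only: norm_mult norm_of_real) (simp add: g_def)
    also have "\<dots> \<le> g ?n * (C * freq_gap lam ?n powr k * (1 + norm s) powr k)"
      by (intro mult_left_mono R) (simp add: g_def)
    also have "\<dots> = C * (1 + norm s) powr k"
      using gap unfolding g_def by (simp add: powr_divide)
    finally show "norm (riesz_mean lam (real (Suc m)) x (b j) s) \<le> C * (1 + norm s) powr k" .
  qed (use assms(1) supp in auto)
  then have "(\<lambda>n. norm (a n)) \<in> O(\<rho>)" unfolding a_def by (rule assms(5))
  then obtain c where "eventually (\<lambda>n. norm (norm (a n)) \<le> c * norm (\<rho> n)) sequentially"
    by (rule landau_o.bigE)
  then obtain N where N: "\<And>n. n \<ge> N \<Longrightarrow> norm (a n) \<le> c * \<bar>\<rho> n\<bar>"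
    by (auto simp: eventually_sequentially)
  have a_r: "norm (a (r j)) = (1/2) ^ j * g (r j)" for j
  proof -
    \<comment> \<open>The humps are disjoint, so only the \<open>j\<close>-th one contributes to the coefficient at \<open>r j\<close>.\<close>
    have "b i (r j) = 0" if "i \<noteq> j" for i
      using that r(2)[of i j] r(2)[of j i] by (intro supp) (cases "i < j"; auto)
    then have "a (r j) = (\<Sum>i\<in>{j}. (1/2) ^ i * b i (r j))"
      unfolding a_def using r(1)[of j] by (intro sum.mono_neutral_right) auto
    also have "\<dots> = (1/2) ^ j * of_real (g (r j))"
      by (simp add: b_def block_coeff_def)
    finally show ?thesis by (simp add: norm_mult norm_power norm_divide g_def)
  qed
  obtain j0 where j0: "c < 2 ^ j0" using real_arch_pow[of 2 c] by auto
  define j where "j = max j0 N"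
  have "(2::real) ^ j0 \<le> 2 ^ j" unfolding j_def by (intro power_increasing) auto
  then have "c \<le> 2 ^ j" using j0 by linarith
  have rho: "\<rho> (r j) > 0" using r2[of j] by (intro assms(4)) simp
  have "2 ^ j * \<rho> (r j) = (1/2) ^ j * (4 ^ j * \<rho> (r j))"
  proof -
    have "(4::real) ^ j = 2 ^ j * 2 ^ j" by (simp flip: power_mult_distrib)
    then show ?thesis by (simp add: power_divide)
  qed
  also have "\<dots> < (1/2) ^ j * g (r j)"
    using r(3)[of j] rho by (intro mult_strict_left_mono) (auto simp: g_def)
  also have "\<dots> \<le> c * \<rho> (r j)"
    using N[of "r j"] r(1)[of j] rho unfolding a_r j_def by simp
  also have "\<dots> \<le> 2 ^ j * \<rho> (r j)"
    using \<open>c \<le> 2 ^ j\<close> rho by (intro mult_right_mono) auto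
  finally show False by simp
qed

end
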